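(* In the setting described in the context, let $\gamma_A^d>0$ be the downlink SINR threshold and let $$\mathsf{SINR}^d_A=\frac{P_{ABS}\,G^d_A\,PL_a(Z_A)}{P_{TBS}\,H^d_A\,d_A^{-\alpha_T}+\sigma^2}$$ be the downlink SINR at the ABS-supported device. Then $$\Pr(\mathsf{SINR}^d_A>\gamma_A^d)=\sum_{k\in\{L,N\}}\int_h^{\sqrt{R_2^2+h^2}}\int_0^{2\pi}\sum_{n=0}^{m_k-1}\frac{(-s_k)^n}{n!}e^{-s_k\sigma^2}\sum_{j=0}^n\binom nj(-\sigma^2)^{n-j}\,\frac{d^j}{ds^j}\mathcal L(s|z,\theta)\Big|_{s=s_k}\,\frac{p_k(z)}{2\pi}\,f_{Z_A}(z)\,d\theta\,dz,$$ where $s_k=s_k(z)=\frac{m_k\gamma_A^dz^{\alpha_k}}{P_{ABS}\eta_k}$, $f_{Z_A}(z)=\frac{2z}{R_2^2}$, and $$\mathcal L(s|z,\theta)=\frac{1}{1+\dfrac{sP_{TBS}}{\left(z^2-h^2+d^2-2\sqrt{z^2-h^2}\,d\cos\theta\right)^{\alpha_T/2}}}.$$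
   Context: Geometry: a terrestrial base station (TBS) is at the origin of the ground plane. A stadium $\mathcal S_2$ is a disk of radius $R_2>0$ in the ground plane whose center is at distance $d>0$ from the TBS. An aerial base station (ABS) is at height $h>0$ above the center of $\mathcal S_2$. An ABS-supported device (AsD) is uniformly distributed on $\mathcal S_2$; $Z_A$ is its 3-D Euclidean distance to the ABS and $d_A$ its distance to the TBS. Aerial link (ABS–AsD): given the AsD position with $Z_A=z$, the link is line-of-sight (LOS, index $L$) with probability $p_L(z)\in[0,1]$ and non-line-of-sight (NLOS, index $N$) with probability $p_N(z)=1-p_L(z)$, where $p_L$ is a given measurable function. In state $k\in\{L,N\}$ the path-loss is $PL_a(z)=\eta_kz^{-\alpha_k}$ ($\eta_k,\alpha_k>0$, $\eta_L>\eta_N$), and the Nakagami fading power gain $G^d_A$ is Gamma distributed with shape $m_k$ and mean $1$, where $m_L,m_N$ are positive integers. Terrestrial link (TBS–AsD): path-loss exponent $\alpha_T>0$, Rayleigh fading power gain $H^d_A$ exponential with unit mean, independent of the position, the link state and $G^d_A$; given the link state, $G^d_A$ is independent of the position. The TBS and ABS transmit with constant powers $P_{TBS},P_{ABS}>0$. Noise power is $\sigma^2>0$. The integrand may be undefined on the null set where $z^2-h^2+d^2-2\sqrt{z^2-h^2}\,d\cos\theta=0$. *)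

theory Defs
  imports "HOL-Probability.Probability"
begin

datatype link_state = LOS | NLOS

definition link_prob :: "(real \<Rightarrow> real) \<Rightarrow> link_state \<Rightarrow> real \<Rightarrow> real" where
  "link_prob pL k z = (case k of LOS \<Rightarrow> pL z | NLOS \<Rightarrow> 1 - pL z)"

definition path_loss :: "(link_state \<Rightarrow> real) \<Rightarrow> (link_state \<Rightarrow> real) \<Rightarrow> link_state \<Rightarrow> real \<Rightarrow> real" where
  "path_loss \<eta> \<alpha> k z = \<eta> k * z powr (- \<alpha> k)"

(* Points of 3-space are pairs (ground position, height).  The product metric is the Euclidean
   one, so this is the 3-D distance from the ground point x to the point at height h above c. *)
definition abs_dist :: "real^2 \<Rightarrow> real \<Rightarrow> real^2 \<Rightarrow> real" where
  "abs_dist c h x = dist (x, 0::real) (c, h)"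

(* erlang_density k l is the Gamma density with shape k + 1 and rate l; shape m and rate m give
   mean 1 (proved below).  Meaningful for m \<ge> 1 only. *)
definition nakagami_gain_density :: "nat \<Rightarrow> real \<Rightarrow> real" where
  "nakagami_gain_density m = erlang_density (m - 1) (real m)"

(* Independence of random variables with possibly different value types, as independence of the
   generated sigma-algebras; indep_var requires both value types to coincide. *)
definition indep_rv ::
  "'a measure \<Rightarrow> 'b measure \<Rightarrow> ('a \<Rightarrow> 'b) \<Rightarrow> 'c measure \<Rightarrow> ('a \<Rightarrow> 'c) \<Rightarrow> bool" where
  "indep_rv M S X T Y \<longleftrightarrow>
     X \<in> measurable M S \<and> Y \<in> measurable M T \<and>
     prob_space.indep_set M
       (sets (vimage_algebra (space M) X S)) (sets (vimage_algebra (space M) Y T))"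

(* The conditional probability measure given K = k, provided that this event has positive
   probability. *)
definition given_state :: "'a measure \<Rightarrow> ('a \<Rightarrow> link_state) \<Rightarrow> link_state \<Rightarrow> 'a measure" where
  "given_state M K k = uniform_measure M {\<omega> \<in> space M. K \<omega> = k}"

(* The TBS is the origin of the ground plane real^2.  For the ABS-supported device: x is its
   position, k its aerial link state, g and f are the aerial and terrestrial fading power gains.
   The noise power is \<sigma>\<^sup>2. *)
definition downlink_sinr ::
  "real \<Rightarrow> real \<Rightarrow> real \<Rightarrow> real \<Rightarrow> (link_state \<Rightarrow> real) \<Rightarrow> (link_state \<Rightarrow> real) \<Rightarrow>
   real^2 \<Rightarrow> real \<Rightarrow> real^2 \<Rightarrow> link_state \<Rightarrow> real \<Rightarrow> real \<Rightarrow> real" where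
  "downlink_sinr P_TBS P_ABS \<sigma> \<alpha>_T \<eta> \<alpha> c h x k g f =
     P_ABS * g * path_loss \<eta> \<alpha> k (abs_dist c h x) /
     (P_TBS * f * dist x 0 powr (- \<alpha>_T) + \<sigma>\<^sup>2)"

definition s_param ::
  "real \<Rightarrow> real \<Rightarrow> (link_state \<Rightarrow> real) \<Rightarrow> (link_state \<Rightarrow> real) \<Rightarrow> (link_state \<Rightarrow> nat) \<Rightarrow>
   link_state \<Rightarrow> real \<Rightarrow> real" where
  "s_param \<gamma> P_ABS \<eta> \<alpha> m k z = real (m k) * \<gamma> * z powr \<alpha> k / (P_ABS * \<eta> k)"

definition f_ZA :: "real \<Rightarrow> real \<Rightarrow> real" where
  "f_ZA R\<^sub>2 z = 2 * z / R\<^sub>2\<^sup>2"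

(* If the base of the power vanishes, which happens for almost no (z, \<theta>), the quotient is 0 by
   the convention for division by zero. *)
definition laplace_interf ::
  "real \<Rightarrow> real \<Rightarrow> real \<Rightarrow> real \<Rightarrow> real \<Rightarrow> real \<Rightarrow> real \<Rightarrow> real" where
  "laplace_interf P_TBS \<alpha>_T h d z \<theta> s =
     1 / (1 + s * P_TBS /
       (z\<^sup>2 - h\<^sup>2 + d\<^sup>2 - 2 * sqrt (z\<^sup>2 - h\<^sup>2) * d * cos \<theta>) powr (\<alpha>_T / 2))"

lemma (in prob_space) indep_rv_iff_indep_var: "indep_rv M S X T Y \<longleftrightarrow> indep_var S X T Y"
  unfolding indep_rv_def indep_var_eq sets_vimage_algebra by simp

lemma (in prob_space) nakagami_gain_expectation:
  assumes "m \<ge> 1" and "distributed M lborel G (nakagami_gain_density m)"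
  shows "expectation G = 1"
  using erlang_ith_moment[of "real m" G "m - 1" 1] assms
  by (cases m) (simp_all add: nakagami_gain_density_def)

end

theory Submission
  imports Defs
begin

text \<open>Given the position and the link state, the SINR exceeds the threshold iff the aerial gain
  exceeds an affine function of the terrestrial gain. The tail of the Gamma distribution with
  integer shape is a finite sum of terms t^n exp (- t) / n!; the binomial theorem and the
  moments of the exponential distribution turn its average over the terrestrial gain into
  derivatives of the Laplace transform. The defining property of conditional expectation replaces
  the link-state indicator by the link probability, and polar coordinates around the centre of
  the disk, with angle measured from the direction of the TBS, give the double integral.\<close>

subsection \<open>Polar coordinates on a disk\<close>

text \<open>The link state depends on the position and the law of the aerial gain on the link state,
  so the random quantities cannot be integrated against one product law. The order of elimination
  matters: the terrestrial gain goes first, being independent of all the rest jointly; the aerial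
  gain next, under the measure conditioned on the state; the state last, once the remaining factor
  is a function of the position alone and can be moved through the conditional expectation.
  Differentiation under the integral sign is avoided: the derivatives of the Laplace transform and
  the weighted exponential moments are computed separately in closed form and then seen to coincide.
  Integrability comes from boundedness throughout: the averaged tail is a probability, hence between
  0 and 1, although its alternating sum does not show this.\<close>

lemma vector2_measurable:
  "(\<lambda>(a, b). vector [a, b] :: real^2) \<in> borel_measurable (lborel \<Otimes>\<^sub>M lborel)"
proof -
  have "(\<lambda>(a, b). vector [a, b] :: real^2) = (\<lambda>p. fst p *\<^sub>R axis 1 1 + snd p *\<^sub>R axis 2 1)"
    by (auto simp: vec_eq_iff forall_2 axis_def)
  then show ?thesis by simp
qed

text \<open>Connects the two models of the plane: the change of variables takes place in
  \<open>real^2\<close>, the iterated integral in the product of two lines. Lebesgue measure is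
  determined by its values on boxes, and a box pulls back to a product of intervals.\<close>

lemma lborel_real2_eq:
  "(lborel :: (real^2) measure) = distr (lborel \<Otimes>\<^sub>M lborel) borel (\<lambda>(a, b). vector [a, b])"
proof (rule lborel_eqI)
  note [measurable] = vector2_measurable
  fix l u :: "real^2" assume le: "\<And>b. b \<in> Basis \<Longrightarrow> l \<bullet> b \<le> u \<bullet> b"
  have le': "l $ i \<le> u $ i" for i
    using le[of "axis i 1"] by (auto simp: Basis_vec_def inner_axis)
  have "(\<lambda>(a, b). vector [a, b] :: real^2) -` box l u = {l$1<..<u$1} \<times> {l$2<..<u$2}"
    by (auto simp: mem_box_cart forall_2)
  then have "emeasure (distr (lborel \<Otimes>\<^sub>M lborel) borel (\<lambda>(a, b). vector [a, b] :: real^2)) (box l u)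
      = emeasure (lborel \<Otimes>\<^sub>M lborel) ({l$1<..<u$1} \<times> {l$2<..<u$2})"
    by (subst emeasure_distr) (auto simp: space_pair_measure)
  also have "\<dots> = ennreal ((u$1 - l$1) * (u$2 - l$2))"
    using le' by (subst lborel.emeasure_pair_measure_Times) (auto simp: ennreal_mult)
  also have "(u$1 - l$1) * (u$2 - l$2) = (\<Prod>b\<in>Basis. (u - l) \<bullet> b)"
  proof -
    have "(Basis :: (real^2) set) = {axis 1 1, axis 2 1}"
      unfolding Basis_vec_def UNIV_2 by auto
    moreover have "axis 1 1 \<noteq> (axis 2 1 :: real^2)" by (simp add: axis_eq_axis)
    ultimately have "(\<Prod>b\<in>Basis. (u - l) \<bullet> b) = (\<Prod>b\<in>{axis 1 1, axis 2 1}. (u - l) \<bullet> b)"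
      by simp
    with \<open>axis 1 1 \<noteq> (axis 2 1 :: real^2)\<close> show ?thesis by (simp add: inner_axis)
  qed
  finally show "emeasure (distr (lborel \<Otimes>\<^sub>M lborel) borel (\<lambda>(a, b). vector [a, b])) (box l u)
      = (\<Prod>b\<in>Basis. (u - l) \<bullet> b)" .
qed simp

text \<open>The vector \<open>vector [- u$2, u$1]\<close> is \<open>u\<close> after a quarter turn,
  so a unit vector \<open>u\<close> yields an orthonormal frame with angle zero along
  \<open>u\<close>. Keeping \<open>u\<close> free makes any zero direction available.\<close>

definition polar_point :: "real^2 \<Rightarrow> real^2 \<Rightarrow> real \<Rightarrow> real \<Rightarrow> real^2" where
  "polar_point c u r \<theta> = c + (r * cos \<theta>) *\<^sub>R u + (r * sin \<theta>) *\<^sub>R vector [- u$2, u$1]"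

lemma inner_real2: "(x::real^2) \<bullet> y = x$1 * y$1 + x$2 * y$2"
  by (simp add: inner_vec_def sum_2)

lemma unit_real2: "norm (u::real^2) = 1 \<Longrightarrow> (u$1)\<^sup>2 + (u$2)\<^sup>2 = 1"
  by (simp add: norm_eq_1 inner_real2 power2_eq_square)

lemma dist_polar_point:
  assumes "norm u = 1"
  shows "dist (polar_point c u r \<theta>) c = \<bar>r\<bar>"
proof -
  define C S where "C = cos \<theta>" and "S = sin \<theta>"
  have "(dist (polar_point c u r \<theta>) c)\<^sup>2 = r\<^sup>2 * (C\<^sup>2 + S\<^sup>2) * ((u$1)\<^sup>2 + (u$2)\<^sup>2)"
    unfolding dist_norm power2_norm_eq_inner inner_real2 polar_point_def C_def[symmetric] S_def[symmetric]
    by (simp add: power2_eq_square algebra_simps)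
  also have "\<dots> = \<bar>r\<bar>\<^sup>2"
    using unit_real2[OF assms] by (simp add: C_def S_def)
  finally show ?thesis
    using power2_eq_imp_eq[of "dist (polar_point c u r \<theta>) c" "\<bar>r\<bar>"] by simp
qed

lemma polar_point_surj:
  assumes "norm u = 1"
  obtains \<theta> where "0 \<le> \<theta>" "\<theta> < 2 * pi" "x = polar_point c u (dist x c) \<theta>"
proof (cases "x = c")
  case True
  then show ?thesis using that[of 0] by (simp add: polar_point_def)
next
  case False
  define y where "y = x - c"
  define r where "r = dist x c"
  have r: "r > 0" "r\<^sup>2 = (y$1)\<^sup>2 + (y$2)\<^sup>2"
    using False inner_real2[of y y] power2_norm_eq_inner[of y]
    by (simp_all add: r_def y_def dist_norm power2_eq_square)
  note u = unit_real2[OF assms]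
  \<comment> \<open>\<open>a\<close> and \<open>b\<close> are the coordinates of the unit vector
    \<open>y / r\<close> in the frame of \<open>u\<close> and its quarter turn. Lagrange's identity
    for sums of two squares puts them on the unit circle, which supplies the angle.\<close>
  define a where "a = (y$1 * u$1 + y$2 * u$2) / r"
  define b where "b = (y$2 * u$1 - y$1 * u$2) / r"
  have "a\<^sup>2 + b\<^sup>2 = ((y$1)\<^sup>2 + (y$2)\<^sup>2) * ((u$1)\<^sup>2 + (u$2)\<^sup>2) / r\<^sup>2"
    unfolding a_def b_def by (simp add: power_divide add_divide_distrib[symmetric])
      (simp add: power2_eq_square algebra_simps)
  also have "\<dots> = 1" using r(1) u unfolding r(2)[symmetric] by simp
  finally have "a\<^sup>2 + b\<^sup>2 = 1" .
  then obtain \<theta> where \<theta>: "0 \<le> \<theta>" "\<theta> < 2 * pi" "a = cos \<theta>" "b = sin \<theta>"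
    using sincos_total_2pi by metis
  have ra: "r * a = y$1 * u$1 + y$2 * u$2" "r * b = y$2 * u$1 - y$1 * u$2"
    using r(1) by (simp_all add: a_def b_def)
  have "r * a * u$1 - r * b * u$2 = y$1 * ((u$1)\<^sup>2 + (u$2)\<^sup>2)"
    "r * a * u$2 + r * b * u$1 = y$2 * ((u$1)\<^sup>2 + (u$2)\<^sup>2)"
    using ra by algebra+
  then have "x = polar_point c u r \<theta>"
    using u by (simp add: polar_point_def vec_eq_iff forall_2 y_def \<theta>)
  with \<theta>(1,2) show ?thesis unfolding r_def by (rule that)
qed

lemma polar_point_inj:
  assumes "norm u = 1" "r > 0" "r' > 0" "\<theta> \<in> {0..<2*pi}" "\<theta>' \<in> {0..<2*pi}"
    and eq: "polar_point c u r \<theta> = polar_point c u r' \<theta>'"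
  shows "r = r'" "\<theta> = \<theta>'"
proof -
  show r: "r = r'"
    using arg_cong[OF eq, of "\<lambda>x. dist x c"] assms(1-3) by (simp add: dist_polar_point)
  note u = unit_real2[OF assms(1)]
  \<comment> \<open>In complex terms the two equations below say (a + i b)(u1 + i u2) = 0 with a
    second factor of modulus 1, so both differences vanish.\<close>
  define a b where "a = cos \<theta> - cos \<theta>'" and "b = sin \<theta> - sin \<theta>'"
  have "r * (a * u$1 - b * u$2) = 0" "r * (a * u$2 + b * u$1) = 0"
    using eq unfolding polar_point_def r[symmetric]
    by (simp_all add: vec_eq_iff forall_2 a_def b_def algebra_simps)
  then have ab: "a * u$1 = b * u$2" "a * u$2 + b * u$1 = 0"
    using assms by auto
  have "a * ((u$1)\<^sup>2 + (u$2)\<^sup>2) = 0" "b * ((u$1)\<^sup>2 + (u$2)\<^sup>2) = 0"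
    using ab by algebra+
  then have "a = 0" "b = 0" using u by simp_all
  then have "sin \<theta> = sin \<theta>' \<and> cos \<theta> = cos \<theta>'" by (simp add: a_def b_def)
  \<comment> \<open>Two angles of the half-open interval differ by less than a full turn, which
    forces the multiple \<open>n\<close> to be 0.\<close>
  then obtain n :: int where n: "\<theta> = \<theta>' + 2 * pi * n" by (auto simp: sin_cos_eq_iff)
  then have "\<bar>2 * pi * n\<bar> < 2 * pi" using assms by auto
  then have "\<bar>real_of_int n\<bar> < 1" by (simp add: abs_mult)
  then have "n = 0" by linarith
  with n show "\<theta> = \<theta>'" by simp
qed

lemma has_derivative_polar_point:
  "((\<lambda>p::real^2. polar_point c u (p$1) (p$2)) has_derivative
     (\<lambda>q. (q$1 * cos (p$2) - p$1 * sin (p$2) * q$2) *\<^sub>R u +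
          (q$1 * sin (p$2) + p$1 * cos (p$2) * q$2) *\<^sub>R vector [- u$2, u$1])) (at p within S)"
  unfolding polar_point_def
  by (auto intro!: derivative_eq_intros bounded_linear_imp_has_derivative[OF bounded_linear_vec_nth]
      simp: algebra_simps)

text \<open>The columns are a positively oriented orthonormal frame whose second vector is stretched
  by \<open>r\<close>.\<close>

lemma det_polar_point:
  assumes "norm (u::real^2) = 1"
  shows "det (matrix (\<lambda>q::real^2. (q$1 * cos t - r * sin t * q$2) *\<^sub>R u +
          (q$1 * sin t + r * cos t * q$2) *\<^sub>R vector [- u$2, u$1])) = r"
proof -
  define C S where "C = cos t" and "S = sin t"
  have "det (matrix (\<lambda>q::real^2. (q$1 * C - r * S * q$2) *\<^sub>R u +
          (q$1 * S + r * C * q$2) *\<^sub>R vector [- u$2, u$1]))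
     = r * (S\<^sup>2 + C\<^sup>2) * ((u$1)\<^sup>2 + (u$2)\<^sup>2)"
    by (simp add: det_2 matrix_def axis_def power2_eq_square algebra_simps)
  then show ?thesis using unit_real2[OF assms] by (simp add: C_def S_def)
qed

lemma polar_point_measurable [measurable]:
  "(\<lambda>p. polar_point c u (fst p) (snd p)) \<in> borel_measurable (borel \<Otimes>\<^sub>M borel)"
  unfolding polar_point_def by measurable

text \<open>The bound on \<open>F\<close> makes both sides integrable over sets of finite measure,
  as the change of variables and Fubini's theorem demand.\<close>

lemma integral_cball_polar:
  fixes F :: "real^2 \<Rightarrow> real"
  assumes u: "norm u = 1" and F[measurable]: "F \<in> borel_measurable borel"
    and bnd: "\<And>x. \<bar>F x\<bar> \<le> B"
  shows "(LINT x:cball c R|lborel. F x) =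
    (LINT r:{0..R}|lborel. LINT \<theta>:{0..2 * pi}|lborel. r * F (polar_point c u r \<theta>))"
proof -
  \<comment> \<open>Injectivity dictates the shape of \<open>S\<close>: radius 0 is removed, and
    angle \<open>2 * pi\<close> would repeat angle 0. The image then misses only the centre of the
    disk, and both omissions are null sets that are put back separately.\<close>
  define S where "S = {p::real^2. 0 < p$1 \<and> p$1 \<le> R \<and> 0 \<le> p$2 \<and> p$2 < 2 * pi}"
  define g where "g = (\<lambda>p::real^2. polar_point c u (p$1) (p$2))"
  define D where "D p = (\<lambda>q::real^2. (q$1 * cos (p$2) - p$1 * sin (p$2) * q$2) *\<^sub>R u +
          (q$1 * sin (p$2) + p$1 * cos (p$2) * q$2) *\<^sub>R vector [- u$2, u$1])" for p :: "real^2"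
  have S[measurable]: "S \<in> sets borel"
  proof -
    have "Measurable.pred borel (\<lambda>p::real^2. 0 < p$1 \<and> p$1 \<le> R \<and> 0 \<le> p$2 \<and> p$2 < 2 * pi)"
      by measurable
    then show ?thesis by (simp add: S_def pred_def)
  qed
  have img: "g ` S = cball c R - {c}"
  proof (intro equalityI subsetI)
    fix x assume "x \<in> g ` S"
    then obtain p where p: "p \<in> S" "x = g p" by auto
    have "dist x c = p$1" using p by (simp add: g_def S_def dist_polar_point[OF u])
    then show "x \<in> cball c R - {c}" using p by (auto simp: S_def dist_commute)
  next
    fix x assume x: "x \<in> cball c R - {c}"
    obtain \<theta> where "0 \<le> \<theta>" "\<theta> < 2 * pi" "x = polar_point c u (dist x c) \<theta>"
      using polar_point_surj[OF u] .
    then show "x \<in> g ` S"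
      using x by (intro image_eqI[of _ _ "vector [dist x c, \<theta>]"]) (auto simp: g_def S_def dist_commute)
  qed
  have inj: "inj_on g S"
  proof (rule inj_onI)
    fix p q assume "p \<in> S" "q \<in> S" "g p = g q"
    then have "p$1 = q$1" "p$2 = q$2"
      using polar_point_inj[OF u, of "p$1" "q$1" "p$2" "q$2" c] by (auto simp: S_def g_def)
    then show "p = q" by (simp add: vec_eq_iff forall_2)
  qed
  have der: "(g has_derivative D p) (at p within S)" for p
    unfolding g_def D_def by (rule has_derivative_polar_point)
  have detD: "\<bar>det (matrix (D p))\<bar> = p$1" if "p \<in> S" for p
    using that det_polar_point[OF u, of "p$2" "p$1"] by (simp add: D_def S_def)
  have int: "set_integrable lborel (cball c R - {c}) F"
    unfolding set_integrable_def
  proof (rule integrableI_bounded_set_indicator[where B=B])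
    show "emeasure lborel (cball c R - {c}) < \<infinity>"
      by (rule order.strict_trans1[OF emeasure_mono[of _ "cball c R"]]) (use emeasure_bounded_finite[of "cball c R"] in auto)
  qed (use bnd in auto)
  have "(LINT x:cball c R|lborel. F x) = (LINT x:cball c R - {c}|lborel. F x)"
    unfolding set_lebesgue_integral_def
  proof (rule integral_cong_AE)
    show "AE x in lborel. indicat_real (cball c R) x *\<^sub>R F x = indicat_real (cball c R - {c}) x *\<^sub>R F x"
      using AE_lborel_singleton[of c] by (auto elim!: eventually_mono split: split_indicator)
  qed (auto intro!: borel_measurable_times borel_measurable_indicator)
  \<comment> \<open>The change of variables theorem is about vector-valued integrands, so the values
    of \<open>F\<close> are viewed as vectors with one component.\<close>
  have "vec (integral (g ` S) F) = integral (g ` S) (\<lambda>x. vec (F x) :: real^1)"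
    by (simp add: integral_on_1_eq)
  also have "\<dots> = integral S (\<lambda>p. \<bar>det (matrix (D p))\<bar> *\<^sub>R (vec (F (g p)) :: real^1))"
  proof (rule integral_change_of_variables[OF _ der inj])
    show "(\<lambda>x. vec (F x) :: real^1) absolutely_integrable_on g ` S \<or>
      (\<lambda>p. \<bar>det (matrix (D p))\<bar> *\<^sub>R (vec (F (g p)) :: real^1)) absolutely_integrable_on S"
    proof
      have "integrable lebesgue (\<lambda>x. (indicator (cball c R - {c}) x *\<^sub>R F x) *\<^sub>R (vec 1 :: real^1))"
        using int unfolding set_integrable_def
        by (intro integrable_scaleR_left) (auto simp: integrable_completion)
      then show "(\<lambda>x. vec (F x) :: real^1) absolutely_integrable_on g ` S"
        unfolding set_integrable_def img
        by (rule Bochner_Integration.integrable_cong[THEN iffD1, OF refl, rotated])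
          (auto simp: vec_eq_iff)
    qed
  qed auto
  also have "\<dots> = integral S (\<lambda>p. vec (p$1 * F (g p)) :: real^1)"
    by (intro integral_cong) (simp add: detD vec_eq_iff)
  also have "\<dots> = vec (integral S (\<lambda>p. p$1 * F (g p)))"
    by (simp add: integral_on_1_eq)
  finally have I2: "integral (g ` S) F = integral S (\<lambda>p. p$1 * F (g p))"
    by (simp add: vec_eq_iff)
  have gm[measurable]: "g \<in> borel_measurable borel"
    unfolding g_def polar_point_def by measurable
  have intS: "set_integrable lborel S (\<lambda>p. p$1 * F (g p))"
    unfolding set_integrable_def
  proof (rule integrableI_bounded_set_indicator[where B="R * B"])
    have "S \<subseteq> cbox 0 (vector [R, 2 * pi])"
      by (auto simp: S_def mem_box_cart forall_2)
    then have "bounded S" by (rule bounded_subset[OF bounded_cbox])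
    then show "emeasure lborel S < \<infinity>" using emeasure_bounded_finite by auto
    have "0 \<le> B" using bnd[of 0] by linarith
    then show "AE p in lborel. p \<in> S \<longrightarrow> norm (p $ 1 * F (g p)) \<le> R * B"
      using bnd by (auto simp: abs_mult S_def intro!: mult_mono)
  qed auto
  define f where "f = (\<lambda>(r, \<theta>). indicator S (vector [r, \<theta>]) *\<^sub>R (r * F (polar_point c u r \<theta>)))"
  have f_eq: "f = (\<lambda>q. (\<lambda>p. indicator S p *\<^sub>R (p$1 * F (g p))) (case q of (r, \<theta>) \<Rightarrow> vector [r, \<theta>]))"
    by (auto simp: f_def g_def fun_eq_iff)
  have "integrable (distr (lborel \<Otimes>\<^sub>M lborel) borel (\<lambda>(a, b). vector [a, b])) (\<lambda>p. indicator S p *\<^sub>R (p$1 * F (g p)))"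
    using intS unfolding set_integrable_def lborel_real2_eq[symmetric] .
  then have intf: "integrable (lborel \<Otimes>\<^sub>M lborel) f"
    unfolding f_eq using vector2_measurable by (subst (asm) integrable_distr_eq) auto
  have "(LINT x:cball c R|lborel. F x) = (LINT x:cball c R - {c}|lborel. F x)"
    by fact
  also have "\<dots> = integral S (\<lambda>p. p$1 * F (g p))"
    using set_borel_integral_eq_integral(2)[OF int] I2 by (simp add: img)
  also have "\<dots> = (LINT p:S|lborel. p$1 * F (g p))"
    using set_borel_integral_eq_integral(2)[OF intS] by simp
  also have "\<dots> = integral\<^sup>L (lborel \<Otimes>\<^sub>M lborel) f"
    unfolding f_eq set_lebesgue_integral_def
    by (subst lborel_real2_eq, subst integral_distr[OF vector2_measurable]) auto
  also have "\<dots> = (LINT r|lborel. LINT \<theta>|lborel. f (r, \<theta>))"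
    using lborel_pair.integral_fst'[OF intf] by simp
  also have "\<dots> = (LINT r:{0..R}|lborel. LINT \<theta>:{0..2 * pi}|lborel. r * F (polar_point c u r \<theta>))"
    unfolding set_lebesgue_integral_def
  proof (rule integral_cong_AE)
    have [measurable]: "f \<in> borel_measurable (lborel \<Otimes>\<^sub>M lborel)"
      using intf by simp
    show "(\<lambda>r. LINT \<theta>|lborel. f (r, \<theta>)) \<in> borel_measurable lborel"
      by measurable
    show "(\<lambda>r. indicat_real {0..R} r *\<^sub>R
        (LINT \<theta>|lborel. indicat_real {0..2 * pi} \<theta> *\<^sub>R (r * F (polar_point c u r \<theta>))))
      \<in> borel_measurable lborel"
      by measurable
    \<comment> \<open>Back to closed intervals: at a fixed nonzero radius the integrands can differ
      only at the angle \<open>2 * pi\<close>, and the radius 0 is itself a null set.\<close>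
    have "(LINT \<theta>|lborel. f (r, \<theta>)) = indicat_real {0..R} r *\<^sub>R
      (LINT \<theta>|lborel. indicat_real {0..2 * pi} \<theta> *\<^sub>R (r * F (polar_point c u r \<theta>)))" if "r \<noteq> 0" for r
    proof -
      have "(LINT \<theta>|lborel. f (r, \<theta>)) = (LINT \<theta>|lborel. indicat_real {0..R} r *\<^sub>R
        (indicat_real {0..2 * pi} \<theta> *\<^sub>R (r * F (polar_point c u r \<theta>))))"
      proof (rule integral_cong_AE)
        show "(\<lambda>\<theta>. f (r, \<theta>)) \<in> borel_measurable lborel"
          by measurable
        show "(\<lambda>\<theta>. indicat_real {0..R} r *\<^sub>R
            (indicat_real {0..2 * pi} \<theta> *\<^sub>R (r * F (polar_point c u r \<theta>)))) \<in> borel_measurable lborel"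
          unfolding polar_point_def by measurable
        show "AE \<theta> in lborel. f (r, \<theta>) = indicat_real {0..R} r *\<^sub>R
            (indicat_real {0..2 * pi} \<theta> *\<^sub>R (r * F (polar_point c u r \<theta>)))"
          using AE_lborel_singleton[of "2 * pi"] that
          by (auto simp: f_def S_def elim!: eventually_mono split: split_indicator)
      qed
      then show ?thesis by simp
    qed
    with AE_lborel_singleton[of 0] show "AE r in lborel. (LINT \<theta>|lborel. f (r, \<theta>)) =
      indicat_real {0..R} r *\<^sub>R
      (LINT \<theta>|lborel. indicat_real {0..2 * pi} \<theta> *\<^sub>R (r * F (polar_point c u r \<theta>)))"
      by (auto elim!: eventually_mono)
  qed
  finally show ?thesis .
qed

text \<open>With z = sqrt (r^2 + h^2) one has z dz = r dr, so the polar Jacobian \<open>r\<close>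
  becomes the factor \<open>z\<close>, which later yields \<open>f_ZA\<close>. Since
  \<open>h\<close> is positive, the substitution is smooth even at radius 0.\<close>

lemma integral_cball_height_polar:
  fixes F :: "real^2 \<Rightarrow> real"
  assumes u: "norm u = 1" and F[measurable]: "F \<in> borel_measurable borel"
    and bnd: "\<And>x. \<bar>F x\<bar> \<le> B" and "0 \<le> R" "0 < h"
  shows "(LINT x:cball c R|lborel. F x) =
    (LINT z:{h..sqrt (R\<^sup>2 + h\<^sup>2)}|lborel. LINT \<theta>:{0..2 * pi}|lborel.
      z * F (polar_point c u (sqrt (z\<^sup>2 - h\<^sup>2)) \<theta>))"
proof -
  define J where "J r = (LINT \<theta>:{0..2 * pi}|lborel. F (polar_point c u r \<theta>))" for r
  define f where "f z = z * J (sqrt (z\<^sup>2 - h\<^sup>2))" for z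
  define g where "g r = sqrt (r\<^sup>2 + h\<^sup>2)" for r
  have pos: "0 < r\<^sup>2 + h\<^sup>2" for r using \<open>0 < h\<close> by (simp add: add_nonneg_pos)
  have J[measurable]: "J \<in> borel_measurable borel"
    unfolding J_def set_lebesgue_integral_def polar_point_def by measurable
  have bJ: "\<bar>J r\<bar> \<le> 2 * pi * B" for r
  proof -
    have "norm (J r) \<le> (LINT \<theta>|lborel. norm (indicat_real {0..2 * pi} \<theta> *\<^sub>R F (polar_point c u r \<theta>)))"
      unfolding J_def set_lebesgue_integral_def by (rule integral_norm_bound)
    also have "\<dots> \<le> (LINT \<theta>|lborel. B * indicat_real {0..2 * pi} \<theta>)"
    proof (rule integral_mono)
      have [measurable]: "(\<lambda>\<theta>. F (polar_point c u r \<theta>)) \<in> borel_measurable lborel"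
        unfolding polar_point_def by measurable
      show "integrable lborel (\<lambda>\<theta>. norm (indicat_real {0..2 * pi} \<theta> *\<^sub>R F (polar_point c u r \<theta>)))"
        by (intro integrable_norm integrableI_bounded_set_indicator[where B=B])
          (use bnd in \<open>auto simp: emeasure_lborel_Icc_eq\<close>)
    qed (use bnd in \<open>auto simp: emeasure_lborel_Icc_eq split: split_indicator\<close>)
    finally show ?thesis by (simp add: mult_ac)
  qed
  have gR: "g 0 = h" "g R = sqrt (R\<^sup>2 + h\<^sup>2)"
    using \<open>0 < h\<close> by (simp_all add: g_def)
  have int: "set_integrable lborel {g 0..g R} f"
    unfolding set_integrable_def
  proof (rule integrableI_bounded_set_indicator[where B="g R * (2 * pi * B)"])
    have "0 \<le> B" using bnd[of 0] by linarith
    then show "AE z in lborel. z \<in> {g 0..g R} \<longrightarrow> norm (f z) \<le> g R * (2 * pi * B)"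
      using bJ \<open>0 < h\<close> by (auto simp: f_def gR(1) abs_mult intro!: AE_I2 mult_mono)
  qed (auto simp: f_def emeasure_lborel_Icc_eq)
  have der: "(g has_real_derivative r / g r) (at r)" for r
    unfolding g_def using pos[of r] by (auto intro!: derivative_eq_intros simp: field_simps)
  have cont: "continuous_on {0..R} (\<lambda>r. r / g r)"
    unfolding g_def using \<open>0 < h\<close> pos by (intro continuous_intros) (auto simp: less_imp_neq[symmetric])
  have "(LINT z|lborel. f z * indicator {g 0..g R} z) =
      (LINT r|lborel. f (g r) * (r / g r) * indicator {0..R} r)"
    by (rule integral_substitution(2)[OF int der cont _ \<open>0 \<le> R\<close>]) (simp add: g_def)
  also have "\<dots> = (LINT r:{0..R}|lborel. r * J r)"
    unfolding set_lebesgue_integral_def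
  proof (intro Bochner_Integration.integral_cong refl)
    fix r
    \<comment> \<open>For nonnegative \<open>r\<close> the square root inside \<open>f\<close> gives
      back \<open>r\<close>, and the factor \<open>g r\<close> of \<open>f\<close> cancels the
      denominator of the derivative.\<close>
    show "f (g r) * (r / g r) * indicator {0..R} r = indicator {0..R} r *\<^sub>R (r * J r)"
      using pos[of r] by (auto simp: f_def g_def split: split_indicator)
  qed
  also have "\<dots> = (LINT r:{0..R}|lborel. LINT \<theta>:{0..2 * pi}|lborel. r * F (polar_point c u r \<theta>))"
    by (simp add: J_def)
  also have "\<dots> = (LINT x:cball c R|lborel. F x)"
    by (rule integral_cball_polar[OF u F bnd, symmetric])
  finally have "(LINT z:{h..sqrt (R\<^sup>2 + h\<^sup>2)}|lborel. f z) = (LINT x:cball c R|lborel. F x)"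
    unfolding gR set_lebesgue_integral_def[of lborel "{h..sqrt (R\<^sup>2 + h\<^sup>2)}"] by (simp add: mult.commute)
  moreover have "(LINT \<theta>:{0..2 * pi}|lborel. z * F (polar_point c u (sqrt (z\<^sup>2 - h\<^sup>2)) \<theta>)) = f z" for z
    by (simp add: f_def J_def)
  ultimately show ?thesis by simp
qed

subsection \<open>Erlang tails averaged over an exponential variable\<close>

lemma higher_deriv_inverse_affine:
  fixes A :: real
  assumes "1 + s * A \<noteq> 0"
  shows "(deriv ^^ j) (\<lambda>s. 1 / (1 + s * A)) s = (- 1) ^ j * fact j * A ^ j / (1 + s * A) ^ Suc j"
  using assms
proof (induction j arbitrary: s)
  case 0
  then show ?case by simp
next
  case (Suc j)
  \<comment> \<open>The closed form is valid only away from the pole, and a derivative at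
    \<open>s\<close> needs the induction hypothesis on a whole neighbourhood of
    \<open>s\<close>.\<close>
  have "open {s. 1 + s * A \<noteq> 0}"
    by (intro open_Collect_neq continuous_intros)
  with Suc.prems have ev: "\<forall>\<^sub>F t in nhds s. 1 + t * A \<noteq> 0"
    by (auto simp: eventually_nhds)
  have "(deriv ^^ Suc j) (\<lambda>s. 1 / (1 + s * A)) s
      = deriv (\<lambda>s. (- 1) ^ j * fact j * A ^ j / (1 + s * A) ^ Suc j) s"
    using ev by (auto intro!: deriv_cong_ev elim!: eventually_mono simp: Suc.IH)
  also have "\<dots> = (- 1) ^ Suc j * fact (Suc j) * A ^ Suc j / (1 + s * A) ^ Suc (Suc j)"
    using Suc.prems
    by (intro DERIV_imp_deriv) (auto intro!: derivative_eq_intros simp: field_simps simp del: power_Suc, simp add: field_simps)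
  finally show ?case .
qed

text \<open>The sum is the probability that a Poisson variable with mean \<open>l * t\<close> is at
  most \<open>k\<close>: the arrival number k + 1 comes after time \<open>t\<close>. The shape is k
  + 1, so the index \<open>k\<close> is included.\<close>

lemma emeasure_erlang_density_gt:
  assumes "0 < l" "0 \<le> t"
  shows "emeasure (density lborel (erlang_density k l)) {t<..} =
    ennreal (\<Sum>n\<le>k. (l * t) ^ n / fact n * exp (- (l * t)))"
proof -
  interpret prob_space "density lborel (erlang_density k l)"
    by (rule prob_space_erlang_density) fact
  have "emeasure (density lborel (erlang_density k l)) {..t} = ennreal (erlang_CDF k l t)"
    using assms by (intro emeasure_erlang_density)
  then have "prob {..t} = erlang_CDF k l t"
    using assms by (simp add: measure_def)
  moreover have "{t<..} = space (density lborel (erlang_density k l)) - {..t}"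
    by auto
  ultimately have "prob {t<..} = 1 - erlang_CDF k l t"
    using prob_compl[of "{..t}"] by simp
  then show ?thesis
    using assms by (simp add: emeasure_eq_measure erlang_CDF_def)
qed

text \<open>The factor \<open>exp (- (a * y))\<close> tilts the unit exponential density into 1 / (1
  + a) times the exponential density of rate 1 + a, whose moment of order \<open>j\<close> is
  \<open>fact j / (1 + a) ^ j\<close>.\<close>

lemma has_bochner_integral_exponential_moment:
  assumes "0 \<le> a"
  shows "has_bochner_integral lborel (\<lambda>y. exponential_density 1 y * (y ^ j * exp (- (a * y))))
    (fact j / (1 + a) ^ Suc j)"
proof (rule has_bochner_integral_nn_integral)
  have "(\<integral>\<^sup>+ y. ennreal (exponential_density 1 y * (y ^ j * exp (- (a * y)))) \<partial>lborel) =
    (\<integral>\<^sup>+ y. ennreal (1 / (1 + a)) * ennreal (erlang_density 0 (1 + a) y * y ^ j) \<partial>lborel)"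
  proof (intro nn_integral_cong)
    fix y :: real
    have "erlang_density 0 (1 + a) y = (if y < 0 then 0 else (1 + a) * (exp (- y) * exp (- (a * y))))"
      by (simp add: erlang_density_def exp_add[symmetric] algebra_simps)
    then have "exponential_density 1 y * (y ^ j * exp (- (a * y))) = 1 / (1 + a) * (erlang_density 0 (1 + a) y * y ^ j)"
      using assms by (simp add: exponential_density_def)
    then show "ennreal (exponential_density 1 y * (y ^ j * exp (- (a * y)))) =
      ennreal (1 / (1 + a)) * ennreal (erlang_density 0 (1 + a) y * y ^ j)"
      using assms by (simp only: ennreal_mult'[symmetric] zero_le_divide_1_iff)
  qed
  also have "\<dots> = ennreal (1 / (1 + a)) * ennreal (fact j / (1 + a) ^ j)"
    using assms nn_integral_erlang_ith_moment[of "1 + a" 0 j] by (subst nn_integral_cmult) auto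
  also have "\<dots> = ennreal (fact j / (1 + a) ^ Suc j)"
    using assms by (simp add: ennreal_mult[symmetric])
  finally show "(\<integral>\<^sup>+ y. ennreal (exponential_density 1 y * (y ^ j * exp (- (a * y)))) \<partial>lborel) =
    ennreal (fact j / (1 + a) ^ Suc j)" .
qed (use assms in \<open>auto intro!: AE_I2 simp: exponential_density_def\<close>)

text \<open>The right-hand side of the coverage formula for fixed position, with the derivatives
  of the Laplace transform evaluated.\<close>

definition erlang_tail_average :: "nat \<Rightarrow> real \<Rightarrow> real \<Rightarrow> real \<Rightarrow> real" where
  "erlang_tail_average k s N A =
    (\<Sum>n = 0..k. (- s) ^ n / fact n * exp (- s * N) *
      (\<Sum>j = 0..n. real (n choose j) * (- N) ^ (n - j) *
        ((- 1) ^ j * fact j * A ^ j / (1 + s * A) ^ Suc j)))"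

lemma has_bochner_integral_erlang_tail_average:
  assumes "0 \<le> s" "0 \<le> A"
  shows "has_bochner_integral lborel
    (\<lambda>y. exponential_density 1 y * (\<Sum>n\<le>k. (s * (A * y + N)) ^ n / fact n * exp (- (s * (A * y + N)))))
    (erlang_tail_average k s N A)"
proof -
  have "has_bochner_integral lborel
    (\<lambda>y. \<Sum>n = 0..k. (- s) ^ n / fact n * exp (- s * N) *
      (\<Sum>j = 0..n. real (n choose j) * (- N) ^ (n - j) *
        ((- 1) ^ j * A ^ j * (exponential_density 1 y * (y ^ j * exp (- (s * A * y)))))))
    (\<Sum>n = 0..k. (- s) ^ n / fact n * exp (- s * N) *
      (\<Sum>j = 0..n. real (n choose j) * (- N) ^ (n - j) *
        ((- 1) ^ j * A ^ j * (fact j / (1 + s * A) ^ Suc j))))"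
    using assms
    by (intro has_bochner_integral_sum has_bochner_integral_mult_right
        has_bochner_integral_exponential_moment) auto
  moreover have "(\<Sum>n = 0..k. (- s) ^ n / fact n * exp (- s * N) *
      (\<Sum>j = 0..n. real (n choose j) * (- N) ^ (n - j) *
        ((- 1) ^ j * A ^ j * (exponential_density 1 y * (y ^ j * exp (- (s * A * y)))))))
    = exponential_density 1 y * (\<Sum>n\<le>k. (s * (A * y + N)) ^ n / fact n * exp (- (s * (A * y + N))))" for y
  proof -
    \<comment> \<open>The power is written as (-s)^n (- A y - N)^n before expansion. With these
      signs each term contains (- A y)^j exp (- s A y), the derivative of order \<open>j\<close> in
      \<open>s\<close> of exp (- s A y), and this is what matches the derivatives of the Laplace
      transform.\<close>
    have "(- s) ^ n * (\<Sum>j = 0..n. real (n choose j) * (- N) ^ (n - j) * ((- 1) ^ j * A ^ j * y ^ j))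
      = (s * (A * y + N)) ^ n" for n
    proof -
      have "(\<Sum>j = 0..n. real (n choose j) * (- N) ^ (n - j) * ((- 1) ^ j * A ^ j * y ^ j))
          = (\<Sum>j\<le>n. real (n choose j) * (- (A * y)) ^ j * (- N) ^ (n - j))"
        unfolding atMost_atLeast0
        by (intro sum.cong refl) (simp add: power_mult_distrib power_minus[of "A * y"])
      also have "\<dots> = (- (A * y) + - N) ^ n"
        by (rule binomial_ring[symmetric])
      finally show ?thesis by (simp add: power_mult_distrib[symmetric] algebra_simps)
    qed
    note this[symmetric]
    then show ?thesis
      by (simp add: atMost_atLeast0 sum_distrib_left sum_distrib_right exp_add[symmetric] algebra_simps)
         (simp add: mult_exp_exp exp_diff exp_minus sum_divide_distrib algebra_simps)
  qed
  ultimately show ?thesis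
    by (simp add: erlang_tail_average_def mult_ac)
qed

text \<open>Tonelli's theorem lets \<open>g\<close> be integrated out first: for fixed
  \<open>y\<close> the event is a tail event of the Erlang law, with rate times threshold equal to
  \<open>l * \<tau> * (A * y + N)\<close>. The product \<open>l * \<tau>\<close> thus becomes the
  Laplace argument.\<close>

lemma nn_integral_erlang_exceeds_affine_exponential:
  assumes "0 < l" "0 < \<tau>" "0 \<le> A" "0 \<le> N"
  shows "(\<integral>\<^sup>+ g. erlang_density k l g * (\<integral>\<^sup>+ y. ennreal (exponential_density 1 y) *
      indicator {y. g > \<tau> * (A * y + N)} y \<partial>lborel) \<partial>lborel)
    = ennreal (erlang_tail_average k (l * \<tau>) N A)"
proof -
  let ?T = "\<lambda>y. \<Sum>n\<le>k. (l * \<tau> * (A * y + N)) ^ n / fact n * exp (- (l * \<tau> * (A * y + N)))"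
  have "(\<integral>\<^sup>+ g. erlang_density k l g * (\<integral>\<^sup>+ y. ennreal (exponential_density 1 y) *
      indicator {y. g > \<tau> * (A * y + N)} y \<partial>lborel) \<partial>lborel)
    = (\<integral>\<^sup>+ g. \<integral>\<^sup>+ y. erlang_density k l g * (ennreal (exponential_density 1 y) *
      indicator {y. g > \<tau> * (A * y + N)} y) \<partial>lborel \<partial>lborel)"
    by (intro nn_integral_cong nn_integral_cmult[symmetric]) auto
  also have "\<dots> = (\<integral>\<^sup>+ y. \<integral>\<^sup>+ g. erlang_density k l g * (ennreal (exponential_density 1 y) *
      indicator {y. g > \<tau> * (A * y + N)} y) \<partial>lborel \<partial>lborel)"
    by (rule lborel_pair.Fubini'[symmetric]) (simp add: indicator_def)
  also have "\<dots> = (\<integral>\<^sup>+ y. ennreal (exponential_density 1 y * ?T y) \<partial>lborel)"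
  proof (rule nn_integral_cong)
    fix y :: real
    show "(\<integral>\<^sup>+ g. erlang_density k l g * (ennreal (exponential_density 1 y) *
        indicator {y. g > \<tau> * (A * y + N)} y) \<partial>lborel) = ennreal (exponential_density 1 y * ?T y)"
    \<comment> \<open>For negative \<open>y\<close> the threshold may be negative and outside the
      reach of the tail formula, but there the exponential density vanishes.\<close>
    proof (cases "y < 0")
      case True
      then show ?thesis by (simp add: exponential_density_def)
    next
      case False
      then have t: "0 \<le> \<tau> * (A * y + N)" using assms by simp
      have "(\<integral>\<^sup>+ g. erlang_density k l g * (ennreal (exponential_density 1 y) *
          indicator {y. g > \<tau> * (A * y + N)} y) \<partial>lborel)
        = (\<integral>\<^sup>+ g. ennreal (exponential_density 1 y) * (ennreal (erlang_density k l g) * indicator {\<tau> * (A * y + N)<..} g) \<partial>lborel)"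
        by (intro nn_integral_cong) (auto simp: mult_ac split: split_indicator)
      also have "\<dots> = exponential_density 1 y * emeasure (density lborel (erlang_density k l)) {\<tau> * (A * y + N)<..}"
        by (simp add: nn_integral_cmult emeasure_density)
      also have "\<dots> = ennreal (exponential_density 1 y * ?T y)"
        using t assms by (simp add: emeasure_erlang_density_gt ennreal_mult[symmetric] sum_nonneg mult.assoc False)
      finally show ?thesis .
    qed
  qed
  also have "\<dots> = ennreal (erlang_tail_average k (l * \<tau>) N A)"
  proof -
    have *: "has_bochner_integral lborel (\<lambda>y. exponential_density 1 y * ?T y) (erlang_tail_average k (l * \<tau>) N A)"
      using assms by (intro has_bochner_integral_erlang_tail_average) auto
    have "0 \<le> exponential_density 1 y * ?T y" for y
      using assms by (cases "y < 0") (auto simp: exponential_density_def intro!: sum_nonneg mult_nonneg_nonneg)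
    with * show ?thesis
      by (simp add: has_bochner_integral_iff nn_integral_eq_integral)
  qed
  finally show ?thesis .
qed

text \<open>The value is the mean of a tail probability under the exponential law.\<close>

lemma erlang_tail_average_bounds:
  assumes "0 \<le> s" "0 \<le> A" "0 \<le> N"
  shows "0 \<le> erlang_tail_average k s N A" "erlang_tail_average k s N A \<le> 1"
proof -
  let ?T = "\<lambda>y. \<Sum>n\<le>k. (s * (A * y + N)) ^ n / fact n * exp (- (s * (A * y + N)))"
  have T: "0 \<le> ?T y \<and> ?T y \<le> 1" if "0 \<le> y" for y
  proof -
    have t: "0 \<le> s * (A * y + N)" using assms that by simp
    \<comment> \<open>The tail depends only on the product of rate and threshold, so rate 1 with the
      whole product as threshold represents \<open>?T y\<close> as a probability.\<close>
    interpret prob_space "density lborel (erlang_density k 1)"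
      by (rule prob_space_erlang_density) simp
    have "ennreal (?T y) \<le> 1"
      using measure_le_1[of "{s * (A * y + N)<..}"] t by (subst (asm) emeasure_erlang_density_gt) auto
    then show ?thesis using t by (auto intro!: sum_nonneg)
  qed
  have I: "has_bochner_integral lborel (\<lambda>y. exponential_density 1 y * ?T y) (erlang_tail_average k s N A)"
    using assms(1,2) by (rule has_bochner_integral_erlang_tail_average)
  have I1: "has_bochner_integral lborel (exponential_density 1) (1 :: real)"
    using has_bochner_integral_exponential_moment[of 0 0] by simp
  show "0 \<le> erlang_tail_average k s N A"
    unfolding has_bochner_integral_integral_eq[OF I, symmetric]
    using T by (intro integral_nonneg_AE AE_I2) (auto simp: exponential_density_def)
  have "erlang_tail_average k s N A \<le> (LINT y|lborel. exponential_density 1 y)"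
    unfolding has_bochner_integral_integral_eq[OF I, symmetric]
  proof (rule integral_mono)
    show "integrable lborel (\<lambda>y. exponential_density 1 y * ?T y)" "integrable lborel (exponential_density 1)"
      using I I1 by (simp_all only: has_bochner_integral_iff)
    show "exponential_density 1 y * ?T y \<le> exponential_density 1 y" for y
      using T[of y] by (cases "y < 0") (auto simp: exponential_density_def intro!: mult_left_le)
  qed
  then show "erlang_tail_average k s N A \<le> 1"
    unfolding has_bochner_integral_integral_eq[OF I1] .
qed

subsection \<open>Conditioning\<close>

lemma distr_pair_indep_rv:
  assumes "prob_space M" and "indep_rv M S X T Y"
  shows "distr M S X \<Otimes>\<^sub>M distr M T Y = distr M (S \<Otimes>\<^sub>M T) (\<lambda>\<omega>. (X \<omega>, Y \<omega>))"
proof (rule pair_measure_eqI)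
  interpret prob_space M by fact
  have X[measurable]: "X \<in> measurable M S" and Y[measurable]: "Y \<in> measurable M T"
    and ind: "indep_set (sets (vimage_algebra (space M) X S)) (sets (vimage_algebra (space M) Y T))"
    using assms(2) by (auto simp: indep_rv_def)
  show "sigma_finite_measure (distr M S X)" "sigma_finite_measure (distr M T Y)"
    by (auto intro!: finite_measure.axioms(1) finite_measure_distr)
  fix A B assume "A \<in> sets (distr M S X)" "B \<in> sets (distr M T Y)"
  then have [measurable]: "A \<in> sets S" "B \<in> sets T" by auto
  have "prob ((X -` A \<inter> space M) \<inter> (Y -` B \<inter> space M)) = prob (X -` A \<inter> space M) * prob (Y -` B \<inter> space M)"
    by (rule indep_setD[OF ind]) (auto intro!: in_vimage_algebra)
  moreover have "(X -` A \<inter> space M) \<inter> (Y -` B \<inter> space M) = (\<lambda>\<omega>. (X \<omega>, Y \<omega>)) -` (A \<times> B) \<inter> space M"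
    by auto
  ultimately show "emeasure (distr M S X) A * emeasure (distr M T Y) B =
      emeasure (distr M (S \<Otimes>\<^sub>M T) (\<lambda>\<omega>. (X \<omega>, Y \<omega>))) (A \<times> B)"
    by (simp add: emeasure_distr emeasure_eq_measure ennreal_mult)
qed simp

text \<open>Only \<open>X\<close> is replaced by its law. The outer integral stays over
  \<open>M\<close>, so the joint behaviour of the components of \<open>Y\<close> remains available
  for the next conditioning.\<close>

lemma nn_integral_indep_rv:
  assumes "prob_space M" and "indep_rv M S X T Y" and f[measurable]: "f \<in> borel_measurable (S \<Otimes>\<^sub>M T)"
  shows "(\<integral>\<^sup>+ \<omega>. f (X \<omega>, Y \<omega>) \<partial>M) = (\<integral>\<^sup>+ \<omega>. \<integral>\<^sup>+ x. f (x, Y \<omega>) \<partial>distr M S X \<partial>M)"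
proof -
  interpret prob_space M by fact
  have X[measurable]: "X \<in> measurable M S" and Y[measurable]: "Y \<in> measurable M T"
    using assms(2) by (auto simp: indep_rv_def)
  interpret X: prob_space "distr M S X" by (rule prob_space_distr) fact
  interpret Y: prob_space "distr M T Y" by (rule prob_space_distr) fact
  interpret pair_sigma_finite "distr M S X" "distr M T Y" ..
  have "(\<integral>\<^sup>+ \<omega>. f (X \<omega>, Y \<omega>) \<partial>M) = integral\<^sup>N (distr M S X \<Otimes>\<^sub>M distr M T Y) f"
    unfolding distr_pair_indep_rv[OF assms(1,2)] by (simp add: nn_integral_distr)
  also have "\<dots> = (\<integral>\<^sup>+ y. \<integral>\<^sup>+ x. f (x, y) \<partial>distr M S X \<partial>distr M T Y)"
    by (rule nn_integral_snd[symmetric]) simp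
  also have "\<dots> = (\<integral>\<^sup>+ \<omega>. \<integral>\<^sup>+ x. f (x, Y \<omega>) \<partial>distr M S X \<partial>M)"
    by (rule nn_integral_distr) measurable
  finally show ?thesis .
qed

text \<open>Conditioning first on everything but the terrestrial gain, then on position within
  a link state, replaces both gains by integrals against their densities.\<close>

lemma emeasure_state_gains:
  fixes X :: "'a \<Rightarrow> 'b::{second_countable_topology, t2_space}" and K :: "'a \<Rightarrow> link_state" and G H :: "'a \<Rightarrow> real"
  assumes "prob_space M"
    and X[measurable]: "X \<in> borel_measurable M"
    and K[measurable]: "K \<in> measurable M (count_space UNIV)"
    and G[measurable]: "G \<in> borel_measurable M"
    and \<phi>: "prob_space.prob M {\<omega> \<in> space M. K \<omega> = k} > 0 \<Longrightarrow>
         distributed (given_state M K k) lborel G \<phi>"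
    and GX: "prob_space.prob M {\<omega> \<in> space M. K \<omega> = k} > 0 \<Longrightarrow>
         indep_rv (given_state M K k) borel G borel X"
    and \<psi>: "distributed M lborel H \<psi>"
    and H_indep: "indep_rv M borel H (borel \<Otimes>\<^sub>M count_space UNIV \<Otimes>\<^sub>M borel) (\<lambda>\<omega>. (X \<omega>, K \<omega>, G \<omega>))"
    and B[measurable]: "Measurable.pred (borel \<Otimes>\<^sub>M borel \<Otimes>\<^sub>M borel) B"
  shows "emeasure M {\<omega> \<in> space M. K \<omega> = k \<and> B (X \<omega>, G \<omega>, H \<omega>)} =
    (\<integral>\<^sup>+ \<omega>. indicator {\<omega> \<in> space M. K \<omega> = k} \<omega> *
      (\<integral>\<^sup>+ g. \<phi> g * (\<integral>\<^sup>+ y. \<psi> y * indicator {y. B (X \<omega>, g, y)} y \<partial>lborel) \<partial>lborel) \<partial>M)"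
proof -
  interpret prob_space M by fact
  have H[measurable]: "H \<in> borel_measurable M" and [measurable]: "\<psi> \<in> borel_measurable borel"
    and distrH: "distr M borel H = density lborel \<psi>"
    using \<psi> by (auto simp: distributed_def cong: distr_cong)
  define Q where "Q x g = (\<integral>\<^sup>+ y. \<psi> y * indicator {y. B (x, g, y)} y \<partial>lborel)" for x g
  have ind: "(indicator {y. B (x, g, y)} y :: ennreal) = (if B (x, g, y) then 1 else 0)" for x g y
    by simp
  have Q[measurable]: "case_prod Q \<in> borel_measurable (borel \<Otimes>\<^sub>M borel)"
    unfolding Q_def ind by measurable
  let ?k = "{\<omega> \<in> space M. K \<omega> = k}"
  have "emeasure M {\<omega> \<in> space M. K \<omega> = k \<and> B (X \<omega>, G \<omega>, H \<omega>)} =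
    (\<integral>\<^sup>+ \<omega>. indicator {\<omega> \<in> space M. K \<omega> = k \<and> B (X \<omega>, G \<omega>, H \<omega>)} \<omega> \<partial>M)"
    by (rule nn_integral_indicator[symmetric]) measurable
  also have "\<dots> = (\<integral>\<^sup>+ \<omega>. (\<lambda>(y, x, k', g). if k' = k \<and> B (x, g, y) then 1 else 0) (H \<omega>, X \<omega>, K \<omega>, G \<omega>) \<partial>M)"
    by (intro nn_integral_cong) (auto split: split_indicator)
  also have "\<dots> = (\<integral>\<^sup>+ \<omega>. \<integral>\<^sup>+ y. (\<lambda>(y, x, k', g). if k' = k \<and> B (x, g, y) then 1 else 0) (y, X \<omega>, K \<omega>, G \<omega>)
      \<partial>distr M borel H \<partial>M)"
    by (rule nn_integral_indep_rv[OF prob_space_axioms H_indep]) measurable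
  also have "\<dots> = (\<integral>\<^sup>+ \<omega>. Q (X \<omega>) (G \<omega>) * indicator ?k \<omega> \<partial>M)"
    unfolding distrH Q_def
    by (intro nn_integral_cong, subst nn_integral_density)
      (auto simp: ind intro!: nn_integral_cong split: split_indicator)
  also have "\<dots> = (\<integral>\<^sup>+ \<omega>. (\<integral>\<^sup>+ g. \<phi> g * Q (X \<omega>) g \<partial>lborel) * indicator ?k \<omega> \<partial>M)"
  proof (cases "prob ?k > 0")
    \<comment> \<open>Nothing is known about \<open>\<phi>\<close> for a state of probability zero,
      but then the indicator makes both integrals vanish.\<close>
    case False
    then have "AE \<omega> in M. \<omega> \<notin> ?k"
      by (subst AE_iff_measurable[OF _ refl])
        (auto simp: emeasure_eq_measure zero_less_measure_iff cong: conj_cong)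
    then show ?thesis
      by (intro nn_integral_cong_AE) (auto elim!: eventually_mono)
  next
    case True
    have U: "prob_space (given_state M K k)"
      unfolding given_state_def using True by (intro prob_space_uniform_measure) (auto simp: emeasure_eq_measure)
    have sets_U[measurable_cong]: "sets (given_state M K k) = sets M"
      by (simp add: given_state_def)
    have [measurable]: "\<phi> \<in> borel_measurable borel"
      and distrG: "distr (given_state M K k) borel G = density lborel \<phi>"
      using \<phi>[OF True] by (auto simp: distributed_def cong: distr_cong)
    \<comment> \<open>Passage between the conditional measure and \<open>M\<close>: it is used once
      to enter the conditional measure, where the gain is independent of the position, and once to
      leave it.\<close>
    have U_int: "(\<integral>\<^sup>+ \<omega>. f \<omega> \<partial>given_state M K k) * emeasure M ?k = (\<integral>\<^sup>+ \<omega>. f \<omega> * indicator ?k \<omega> \<partial>M)"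
      if [measurable]: "f \<in> borel_measurable M" for f
      unfolding given_state_def using True
      by (subst nn_integral_uniform_measure)
        (auto simp: emeasure_eq_measure ennreal_divide_times ennreal_times_divide intro!: mult_divide_eq_ennreal)
    have "(\<integral>\<^sup>+ \<omega>. Q (X \<omega>) (G \<omega>) \<partial>given_state M K k) =
      (\<integral>\<^sup>+ \<omega>. (\<lambda>(g, x). Q x g) (G \<omega>, X \<omega>) \<partial>given_state M K k)"
      by simp
    also have "\<dots> = (\<integral>\<^sup>+ \<omega>. \<integral>\<^sup>+ g. (\<lambda>(g, x). Q x g) (g, X \<omega>) \<partial>distr (given_state M K k) borel G \<partial>given_state M K k)"
      by (rule nn_integral_indep_rv[OF U GX[OF True]]) measurable
    also have "\<dots> = (\<integral>\<^sup>+ \<omega>. (\<integral>\<^sup>+ g. \<phi> g * Q (X \<omega>) g \<partial>lborel) \<partial>given_state M K k)"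
      unfolding distrG by (simp add: nn_integral_density)
    finally show ?thesis
      by (simp flip: U_int)
  qed
  finally show ?thesis by (simp add: Q_def mult.commute)
qed

text \<open>\<open>v (X \<omega>)\<close> is measurable for the sigma-algebra generated by
  \<open>X\<close>, so replacing the indicator by its conditional expectation preserves the
  integral. The bound on \<open>v\<close> supplies integrability.\<close>

lemma integral_state_indicator:
  fixes X :: "'a \<Rightarrow> 'b::topological_space" and K :: "'a \<Rightarrow> link_state"
  assumes "prob_space M"
    and X[measurable]: "X \<in> borel_measurable M"
    and K[measurable]: "K \<in> measurable M (count_space UNIV)"
    and w[measurable]: "w \<in> borel_measurable borel" and v[measurable]: "v \<in> borel_measurable borel"
    and bnd: "\<And>x. \<bar>v x\<bar> \<le> b"
    and ce: "AE \<omega> in M. real_cond_exp M (vimage_algebra (space M) X borel)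
         (indicator {\<omega> \<in> space M. K \<omega> = LOS}) \<omega> = w (X \<omega>)"
  shows "(LINT \<omega>|M. indicator {\<omega> \<in> space M. K \<omega> = k} \<omega> * v (X \<omega>)) =
    (LINT \<omega>|M. (case k of LOS \<Rightarrow> w (X \<omega>) | NLOS \<Rightarrow> 1 - w (X \<omega>)) * v (X \<omega>))"
proof -
  interpret prob_space M by fact
  let ?F = "vimage_algebra (space M) X borel"
  interpret finite_measure_subalgebra M ?F
    by unfold_locales (auto simp: subalgebra_def sets_vimage_algebra2 intro: measurable_sets[OF X])
  let ?L = "{\<omega> \<in> space M. K \<omega> = LOS}"
  let ?N = "{\<omega> \<in> space M. K \<omega> = NLOS}"
  have vX: "integrable M (\<lambda>\<omega>. v (X \<omega>))"
    using bnd by (intro integrable_const_bound[where B=b]) auto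
  have iL: "integrable M (\<lambda>\<omega>. v (X \<omega>) * indicat_real ?L \<omega>)"
    by (rule integrable_real_mult_indicator[OF _ vX]) measurable
  have mF: "(\<lambda>\<omega>. v (X \<omega>)) \<in> borel_measurable ?F"
    by (rule measurable_compose[OF measurable_vimage_algebra1 v]) auto
  have eqAE: "AE \<omega> in M. v (X \<omega>) * real_cond_exp M ?F (indicator ?L) \<omega> = w (X \<omega>) * v (X \<omega>)"
    using ce by (auto elim!: eventually_mono)
  have mr[measurable]: "real_cond_exp M ?F (indicator ?L) \<in> borel_measurable M"
    by (rule borel_measurable_cond_exp2)
  have L: "(LINT \<omega>|M. indicator ?L \<omega> * v (X \<omega>)) = (LINT \<omega>|M. w (X \<omega>) * v (X \<omega>))"
    using real_cond_exp_intg(2)[OF iL mF] integral_cong_AE[OF _ _ eqAE] by (simp add: mult.commute)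
  have iw: "integrable M (\<lambda>\<omega>. w (X \<omega>) * v (X \<omega>))"
    using real_cond_exp_intg(1)[OF iL mF] integrable_cong_AE[OF _ _ eqAE] by simp
  \<comment> \<open>The hypothesis speaks of \<open>LOS\<close> only; the two indicators add up to
    1, which settles \<open>NLOS\<close>.\<close>
  have "(LINT \<omega>|M. indicator ?N \<omega> * v (X \<omega>)) = (LINT \<omega>|M. v (X \<omega>) - indicator ?L \<omega> * v (X \<omega>))"
  proof (intro Bochner_Integration.integral_cong refl)
    fix \<omega> assume "\<omega> \<in> space M"
    then show "indicator ?N \<omega> * v (X \<omega>) = v (X \<omega>) - indicator ?L \<omega> * v (X \<omega>)"
      by (cases "K \<omega>") auto
  qed
  also have "\<dots> = (LINT \<omega>|M. v (X \<omega>) - w (X \<omega>) * v (X \<omega>))"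
    using vX iL iw L by (simp add: mult.commute)
  finally have N: "(LINT \<omega>|M. indicator ?N \<omega> * v (X \<omega>)) = (LINT \<omega>|M. (1 - w (X \<omega>)) * v (X \<omega>))"
    by (simp add: left_diff_distrib)
  show ?thesis
    by (cases k) (use L N in auto)
qed

subsection \<open>The coverage probability\<close>

lemma abs_dist_eq: "abs_dist c h x = sqrt ((dist x c)\<^sup>2 + h\<^sup>2)"
  by (simp add: abs_dist_def dist_Pair_Pair dist_real_def)

text \<open>The law of cosines in the triangle of TBS, disk centre and device. The centre is
  \<open>- (d *\<^sub>R u)\<close>, so \<open>u\<close> points from it to the TBS and the cosine
  term is negative.\<close>

lemma dist_polar_point_origin:
  assumes "norm u = 1"
  shows "(dist (polar_point (- (d *\<^sub>R u)) u r \<theta>) 0)\<^sup>2 = r\<^sup>2 + d\<^sup>2 - 2 * r * d * cos \<theta>"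
proof -
  define C S where "C = cos \<theta>" and "S = sin \<theta>"
  have "(dist (polar_point (- (d *\<^sub>R u)) u r \<theta>) 0)\<^sup>2
      = (r\<^sup>2 * (C\<^sup>2 + S\<^sup>2) + d\<^sup>2 - 2 * r * d * C) * ((u$1)\<^sup>2 + (u$2)\<^sup>2)"
    unfolding dist_norm power2_norm_eq_inner inner_real2 polar_point_def C_def[symmetric] S_def[symmetric]
    by (simp add: power2_eq_square algebra_simps)
  then show ?thesis
    unfolding unit_real2[OF assms] by (simp add: C_def S_def)
qed

lemma downlink_sinr_gt_iff:
  assumes "P_TBS > 0" "P_ABS > 0" "\<sigma>\<^sup>2 > 0" "\<eta> k > 0" "h > 0" "y \<ge> 0"
  shows "downlink_sinr P_TBS P_ABS \<sigma> \<alpha>_T \<eta> \<alpha> c h x k g y > \<gamma> \<longleftrightarrow>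
    g > \<gamma> * abs_dist c h x powr \<alpha> k / (P_ABS * \<eta> k) * (P_TBS * dist x 0 powr (- \<alpha>_T) * y + \<sigma>\<^sup>2)"
proof -
  define z where "z = abs_dist c h x"
  have z: "0 < z powr \<alpha> k"
    using assms by (simp add: z_def abs_dist_eq add_nonneg_pos less_imp_neq[symmetric])
  have den: "0 < P_TBS * y * dist x 0 powr (- \<alpha>_T) + \<sigma>\<^sup>2"
    using assms by (simp add: add_nonneg_pos)
  have "\<gamma> < P_ABS * g * (\<eta> k * inverse Z) / D \<longleftrightarrow> \<gamma> * Z / (P_ABS * \<eta> k) * D < g"
    if "0 < Z" "0 < D" for Z D
    using that assms(2,4) by (simp add: field_simps)
  from this[OF z den] show ?thesis
    by (simp add: downlink_sinr_def path_loss_def z_def[symmetric] powr_minus mult_ac)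
qed

text \<open>The factor \<open>m k\<close> in \<open>s_param\<close> is the rate of the gain density:
  mean 1 forces the rate to equal the shape, and rate times threshold is the Laplace
  argument.\<close>

lemma sinr_exceedance_given_position:
  assumes "P_TBS > 0" "P_ABS > 0" "\<sigma>\<^sup>2 > 0" "\<gamma> > 0" "\<eta> k > 0" "h > 0" "m k \<ge> 1"
  shows "(\<integral>\<^sup>+ g. nakagami_gain_density (m k) g * (\<integral>\<^sup>+ y. ennreal (exponential_density 1 y) *
      indicator {y. downlink_sinr P_TBS P_ABS \<sigma> \<alpha>_T \<eta> \<alpha> c h x k g y > \<gamma>} y \<partial>lborel) \<partial>lborel)
    = ennreal (erlang_tail_average (m k - 1) (s_param \<gamma> P_ABS \<eta> \<alpha> m k (abs_dist c h x))
        (\<sigma>\<^sup>2) (P_TBS * dist x 0 powr (- \<alpha>_T)))"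
proof -
  let ?\<tau> = "\<gamma> * abs_dist c h x powr \<alpha> k / (P_ABS * \<eta> k)"
  let ?A = "P_TBS * dist x 0 powr (- \<alpha>_T)"
  have "0 < abs_dist c h x"
    using assms by (simp add: abs_dist_eq add_nonneg_pos)
  then have \<tau>: "0 < ?\<tau>" using assms by simp
  have "(\<integral>\<^sup>+ y. ennreal (exponential_density 1 y) *
      indicator {y. downlink_sinr P_TBS P_ABS \<sigma> \<alpha>_T \<eta> \<alpha> c h x k g y > \<gamma>} y \<partial>lborel)
    = (\<integral>\<^sup>+ y. ennreal (exponential_density 1 y) * indicator {y. g > ?\<tau> * (?A * y + \<sigma>\<^sup>2)} y \<partial>lborel)" for g
  proof (rule nn_integral_cong)
    fix y :: real
    show "ennreal (exponential_density 1 y) *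
        indicator {y. downlink_sinr P_TBS P_ABS \<sigma> \<alpha>_T \<eta> \<alpha> c h x k g y > \<gamma>} y
      = ennreal (exponential_density 1 y) * indicator {y. g > ?\<tau> * (?A * y + \<sigma>\<^sup>2)} y"
    \<comment> \<open>A negative \<open>y\<close> could make the denominator of the SINR nonpositive
      and break the equivalence; the density is zero there.\<close>
    proof (cases "y < 0")
      case True
      then show ?thesis by (simp add: exponential_density_def)
    next
      case False
      then show ?thesis
        using downlink_sinr_gt_iff[of P_TBS P_ABS \<sigma> \<eta> k h y, OF assms(1-3,5,6)] by (simp add: indicator_def)
    qed
  qed
  then have "(\<integral>\<^sup>+ g. nakagami_gain_density (m k) g * (\<integral>\<^sup>+ y. ennreal (exponential_density 1 y) *
      indicator {y. downlink_sinr P_TBS P_ABS \<sigma> \<alpha>_T \<eta> \<alpha> c h x k g y > \<gamma>} y \<partial>lborel) \<partial>lborel)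
    = ennreal (erlang_tail_average (m k - 1) (real (m k) * ?\<tau>) (\<sigma>\<^sup>2) ?A)"
    unfolding nakagami_gain_density_def
    using \<tau> assms nn_integral_erlang_exceeds_affine_exponential[of "real (m k)" ?\<tau> ?A "\<sigma>\<^sup>2" "m k - 1"]
    by simp
  then show ?thesis by (simp add: s_param_def mult.assoc)
qed

text \<open>The base of the power is the squared distance to the TBS, and the exponent
  \<open>\<alpha>_T / 2\<close> absorbs the square. At distance 0 the conventions for
  \<open>powr\<close> and for division make the interference term 0 on both sides, so no point is
  excepted. The equality is between functions of \<open>s\<close>, ready to be
  differentiated.\<close>

lemma laplace_interf_polar:
  assumes "norm u = 1" "h \<le> z" "0 < h"
  shows "laplace_interf P_TBS \<alpha>_T h d z \<theta> =
    (\<lambda>s. 1 / (1 + s * (P_TBS * dist (polar_point (- (d *\<^sub>R u)) u (sqrt (z\<^sup>2 - h\<^sup>2)) \<theta>) 0 powr (- \<alpha>_T))))"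
proof -
  let ?D = "dist (polar_point (- (d *\<^sub>R u)) u (sqrt (z\<^sup>2 - h\<^sup>2)) \<theta>) 0"
  have "h\<^sup>2 \<le> z\<^sup>2" using assms by (intro power_mono) auto
  then have base: "z\<^sup>2 - h\<^sup>2 + d\<^sup>2 - 2 * sqrt (z\<^sup>2 - h\<^sup>2) * d * cos \<theta> = ?D\<^sup>2"
    using dist_polar_point_origin[OF assms(1), of d "sqrt (z\<^sup>2 - h\<^sup>2)" \<theta>] by simp
  have "(t\<^sup>2) powr (\<alpha>_T / 2) = t powr \<alpha>_T" if "0 \<le> t" for t :: real
  proof -
    have "t\<^sup>2 = t powr 2" using that by simp
    then show ?thesis by (simp only: powr_powr) simp
  qed
  from this[OF zero_le_dist] have "(?D\<^sup>2) powr (\<alpha>_T / 2) = ?D powr \<alpha>_T"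
    .
  then show ?thesis
    unfolding laplace_interf_def base by (simp only: powr_minus divide_inverse mult.assoc)
qed

theorem theorem4:
  fixes M :: "'a measure"
    and X :: "'a \<Rightarrow> real^2" and K :: "'a \<Rightarrow> link_state" and G H :: "'a \<Rightarrow> real"
    and c :: "real^2" and R\<^sub>2 d h P_TBS P_ABS \<sigma> \<alpha>_T \<gamma> :: real
    and \<eta> \<alpha> :: "link_state \<Rightarrow> real" and m :: "link_state \<Rightarrow> nat"
    and pL :: "real \<Rightarrow> real"
  assumes "prob_space M"
    and "R\<^sub>2 > 0" and "d > 0" and "h > 0" and "dist c 0 = d"
    and "P_TBS > 0" and "P_ABS > 0" and "\<sigma>\<^sup>2 > 0" and "\<alpha>_T > 0" and "\<gamma> > 0"
    and "\<And>k. \<eta> k > 0" and "\<And>k. \<alpha> k > 0" and "\<eta> LOS > \<eta> NLOS" and "\<And>k. m k \<ge> 1"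
    and "set_borel_measurable borel {h..} pL"
    and "\<And>z. z \<ge> h \<Longrightarrow> pL z \<in> {0..1}"
    and position_uniform:
      "distributed M lborel X (\<lambda>x. indicator (cball c R\<^sub>2) x / measure lborel (cball c R\<^sub>2))"
    and "K \<in> measurable M (count_space UNIV)" and "G \<in> borel_measurable M"
    and los_given_position:
      "AE \<omega> in M. real_cond_exp M (vimage_algebra (space M) X borel)
         (indicator {\<omega> \<in> space M. K \<omega> = LOS}) \<omega> = pL (abs_dist c h (X \<omega>))"
    and gain_given_state:
      "\<And>k. prob_space.prob M {\<omega> \<in> space M. K \<omega> = k} > 0 \<Longrightarrow>
         distributed (given_state M K k) lborel G (nakagami_gain_density (m k))"
    and gain_indep_position_given_state:
      "\<And>k. prob_space.prob M {\<omega> \<in> space M. K \<omega> = k} > 0 \<Longrightarrow>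
         indep_rv (given_state M K k) borel G borel X"
    and rayleigh: "distributed M lborel H (exponential_density 1)"
    and rayleigh_indep:
      "indep_rv M borel H (borel \<Otimes>\<^sub>M count_space UNIV \<Otimes>\<^sub>M borel)
         (\<lambda>\<omega>. (X \<omega>, K \<omega>, G \<omega>))"
  shows "\<P>(\<omega> in M. downlink_sinr P_TBS P_ABS \<sigma> \<alpha>_T \<eta> \<alpha> c h (X \<omega>) (K \<omega>) (G \<omega>) (H \<omega>) > \<gamma>) =
    (\<Sum>k\<in>{LOS, NLOS}.
      LINT z:{h..sqrt (R\<^sub>2\<^sup>2 + h\<^sup>2)}|lborel. LINT \<theta>:{0..2 * pi}|lborel.
        (\<Sum>n = 0..m k - 1.
          (- s_param \<gamma> P_ABS \<eta> \<alpha> m k z) ^ n / fact n *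
          exp (- s_param \<gamma> P_ABS \<eta> \<alpha> m k z * \<sigma>\<^sup>2) *
          (\<Sum>j = 0..n. real (n choose j) * (- \<sigma>\<^sup>2) ^ (n - j) *
            (deriv ^^ j) (laplace_interf P_TBS \<alpha>_T h d z \<theta>) (s_param \<gamma> P_ABS \<eta> \<alpha> m k z))) *
        (link_prob pL k z / (2 * pi)) * f_ZA R\<^sub>2 z)"
proof -
  interpret prob_space M by fact
  have X[measurable]: "X \<in> borel_measurable M"
    using position_uniform by (auto simp: distributed_def)
  note K[measurable] = \<open>K \<in> measurable M (count_space UNIV)\<close>
  note G[measurable] = \<open>G \<in> borel_measurable M\<close>
  have H[measurable]: "H \<in> borel_measurable M"
    using rayleigh by (auto simp: distributed_def)
  \<comment> \<open>The unit vector from the centre of the stadium towards the TBS.\<close>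
  define u where "u = - (1 / d) *\<^sub>R c"
  have c: "c = - (d *\<^sub>R u)" and u: "norm u = 1"
    using \<open>d > 0\<close> \<open>dist c 0 = d\<close> by (simp_all add: u_def)
  (* pL is only assumed measurable and bounded on the range {h..} of the distance. *)
  define pL' where "pL' z = indicator {h..} z * pL z" for z
  have [measurable]: "pL' \<in> borel_measurable borel"
    using \<open>set_borel_measurable borel {h..} pL\<close> by (simp add: set_borel_measurable_def pL'_def[abs_def])
  have pL': "pL' z \<in> {0..1}" for z
    using \<open>\<And>z. z \<ge> h \<Longrightarrow> pL z \<in> {0..1}\<close> by (auto simp: pL'_def split: split_indicator)
  have h_le: "h \<le> abs_dist c h x" for x
    using \<open>h > 0\<close> by (simp add: abs_dist_eq real_le_rsqrt)
  define s where "s k x = s_param \<gamma> P_ABS \<eta> \<alpha> m k (abs_dist c h x)" for k x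
  define A where "A x = P_TBS * dist x 0 powr (- \<alpha>_T)" for x :: "real^2"
  define v where "v k x = erlang_tail_average (m k - 1) (s k x) (\<sigma>\<^sup>2) (A x)" for k x
  define w where "w x = pL' (abs_dist c h x)" for x
  define F where "F k x = (case k of LOS \<Rightarrow> w x | NLOS \<Rightarrow> 1 - w x) * v k x" for k x
  have [measurable]: "abs_dist c h \<in> borel_measurable borel"
    unfolding abs_dist_eq[abs_def] by measurable
  have [measurable]: "w \<in> borel_measurable borel"
    unfolding w_def by measurable
  have v_meas[measurable]: "v k \<in> borel_measurable borel" for k
    unfolding v_def erlang_tail_average_def s_def s_param_def A_def by measurable
  have F_meas[measurable]: "F k \<in> borel_measurable borel" for k
    unfolding F_def by (cases k) simp_all
  have v: "0 \<le> v k x" "v k x \<le> 1" for k x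
    unfolding v_def using assms(2-12)
    by (auto intro!: erlang_tail_average_bounds simp: s_def s_param_def A_def less_imp_le)
  have F_bnd: "\<bar>F k x\<bar> \<le> 1" for k x
    using v[of k x] pL'[of "abs_dist c h x"]
    by (cases k) (auto simp: F_def w_def abs_mult intro!: mult_le_one)
  \<comment> \<open>Inside \<open>E k\<close> the SINR is evaluated at the fixed state
    \<open>k\<close> instead of \<open>K \<omega>\<close>, so the exceedance is a predicate of
    position and gains alone.\<close>
  define E where "E k = {\<omega> \<in> space M. K \<omega> = k \<and>
    downlink_sinr P_TBS P_ABS \<sigma> \<alpha>_T \<eta> \<alpha> c h (X \<omega>) k (G \<omega>) (H \<omega>) > \<gamma>}" for k
  have [measurable]: "Measurable.pred (borel \<Otimes>\<^sub>M borel \<Otimes>\<^sub>M borel)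
      (\<lambda>(x, g, y). downlink_sinr P_TBS P_ABS \<sigma> \<alpha>_T \<eta> \<alpha> c h x k g y > \<gamma>)" for k
    unfolding downlink_sinr_def path_loss_def by measurable
  have E_meas[measurable]: "E k \<in> events" for k
    unfolding E_def downlink_sinr_def path_loss_def by measurable
  have prob_E: "prob (E k) = 1 / (pi * R\<^sub>2\<^sup>2) * (LINT x:cball c R\<^sub>2|lborel. F k x)" for k
  proof -
    let ?k = "{\<omega> \<in> space M. K \<omega> = k}"
    have "emeasure M (E k) = (\<integral>\<^sup>+ \<omega>. indicator ?k \<omega> *
      (\<integral>\<^sup>+ g. nakagami_gain_density (m k) g * (\<integral>\<^sup>+ y. ennreal (exponential_density 1 y) *
        indicator {y. downlink_sinr P_TBS P_ABS \<sigma> \<alpha>_T \<eta> \<alpha> c h (X \<omega>) k g y > \<gamma>} y \<partial>lborel) \<partial>lborel) \<partial>M)"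
      unfolding E_def
      using emeasure_state_gains[OF prob_space_axioms X K G gain_given_state
        gain_indep_position_given_state rayleigh rayleigh_indep,
        of k "\<lambda>(x, g, y). downlink_sinr P_TBS P_ABS \<sigma> \<alpha>_T \<eta> \<alpha> c h x k g y > \<gamma>"]
      by simp
    also have "\<dots> = (\<integral>\<^sup>+ \<omega>. ennreal (indicator ?k \<omega> * v k (X \<omega>)) \<partial>M)"
      using v assms(4,6-8,10,11,14)
      by (subst sinr_exceedance_given_position)
        (auto simp: v_def s_def A_def ennreal_mult ennreal_indicator)
    also have "\<dots> = ennreal (LINT \<omega>|M. indicator ?k \<omega> * v k (X \<omega>))"
      using v by (intro nn_integral_eq_integral integrable_const_bound[where B=1])
        (auto simp: abs_mult intro!: mult_le_one)
    finally have "prob (E k) = (LINT \<omega>|M. indicator ?k \<omega> * v k (X \<omega>))"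
      using v by (simp add: measure_def)
    also have "\<dots> = (LINT \<omega>|M. F k (X \<omega>))"
      unfolding F_def
    proof (rule integral_state_indicator[OF prob_space_axioms X K])
      \<comment> \<open>The distance to the ABS is at least \<open>h\<close>, where
        \<open>pL'\<close> and \<open>pL\<close> agree.\<close>
      show "AE \<omega> in M. real_cond_exp M (vimage_algebra (space M) X borel)
          (indicator {\<omega> \<in> space M. K \<omega> = LOS}) \<omega> = w (X \<omega>)"
        using los_given_position h_le by (simp add: w_def pL'_def)
      show "\<bar>v k x\<bar> \<le> 1" for x using v[of k x] by simp
    qed measurable
    also have "\<dots> = (LINT x|lborel. indicator (cball c R\<^sub>2) x / measure lborel (cball c R\<^sub>2) * F k x)"
      by (rule distributed_integral[OF position_uniform, symmetric]) auto
    also have "\<dots> = 1 / (pi * R\<^sub>2\<^sup>2) * (LINT x:cball c R\<^sub>2|lborel. F k x)"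
      using \<open>R\<^sub>2 > 0\<close>
      by (simp add: set_lebesgue_integral_def content_cball unit_ball_vol_2 power2_eq_square)
    finally show ?thesis .
  qed
  have polar: "1 / (pi * R\<^sub>2\<^sup>2) * (LINT x:cball c R\<^sub>2|lborel. F k x) =
      (LINT z:{h..sqrt (R\<^sub>2\<^sup>2 + h\<^sup>2)}|lborel. LINT \<theta>:{0..2 * pi}|lborel.
        (\<Sum>n = 0..m k - 1.
          (- s_param \<gamma> P_ABS \<eta> \<alpha> m k z) ^ n / fact n *
          exp (- s_param \<gamma> P_ABS \<eta> \<alpha> m k z * \<sigma>\<^sup>2) *
          (\<Sum>j = 0..n. real (n choose j) * (- \<sigma>\<^sup>2) ^ (n - j) *
            (deriv ^^ j) (laplace_interf P_TBS \<alpha>_T h d z \<theta>) (s_param \<gamma> P_ABS \<eta> \<alpha> m k z))) *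
        (link_prob pL k z / (2 * pi)) * f_ZA R\<^sub>2 z)" (is "_ = (LINT z:_|_. LINT \<theta>:_|_. ?f z \<theta>)") for k
  proof -
    \<comment> \<open>The uniform density times the Jacobian splits as z / (pi R^2) = 1 / (2 pi) *
      (2 z / R^2), the uniform density of the angle times \<open>f_ZA\<close>.\<close>
    have integrand: "1 / (pi * R\<^sub>2\<^sup>2) * (z * F k (polar_point c u (sqrt (z\<^sup>2 - h\<^sup>2)) \<theta>)) = ?f z \<theta>"
      if "h \<le> z" for z \<theta>
    proof -
      let ?x = "polar_point c u (sqrt (z\<^sup>2 - h\<^sup>2)) \<theta>"
      have "h\<^sup>2 \<le> z\<^sup>2" using that \<open>h > 0\<close> by (intro power_mono) auto
      then have z: "abs_dist c h ?x = z"
        using that \<open>h > 0\<close> by (simp add: abs_dist_eq dist_polar_point[OF u])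
      have "0 \<le> s k ?x" "0 \<le> A ?x"
        using assms(2-12) by (auto simp: s_def s_param_def A_def less_imp_le)
      then have ne: "1 + s k ?x * A ?x \<noteq> 0"
        by (simp add: add_nonneg_eq_0_iff)
      have "laplace_interf P_TBS \<alpha>_T h d z \<theta> = (\<lambda>t. 1 / (1 + t * A ?x))"
        unfolding A_def by (rule laplace_interf_polar[OF u that \<open>h > 0\<close>, where d=d, folded c])
      then have deriv: "(deriv ^^ j) (laplace_interf P_TBS \<alpha>_T h d z \<theta>) (s k ?x) =
          (- 1) ^ j * fact j * A ?x ^ j / (1 + s k ?x * A ?x) ^ Suc j" for j
        using higher_deriv_inverse_affine[OF ne] by (simp only:)
      have s: "s_param \<gamma> P_ABS \<eta> \<alpha> m k z = s k ?x" by (simp add: s_def z)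
      have F: "F k ?x = link_prob pL k z * v k ?x"
        using that by (cases k) (simp_all add: F_def w_def z pL'_def link_prob_def)
      show ?thesis
        unfolding s deriv F v_def erlang_tail_average_def f_ZA_def
        by (simp add: field_simps)
    qed
    have "1 / (pi * R\<^sub>2\<^sup>2) * (LINT x:cball c R\<^sub>2|lborel. F k x) =
      1 / (pi * R\<^sub>2\<^sup>2) * (LINT z:{h..sqrt (R\<^sub>2\<^sup>2 + h\<^sup>2)}|lborel. LINT \<theta>:{0..2 * pi}|lborel.
        z * F k (polar_point c u (sqrt (z\<^sup>2 - h\<^sup>2)) \<theta>))"
      by (rule arg_cong[OF integral_cball_height_polar[OF u F_meas F_bnd less_imp_le[OF \<open>R\<^sub>2 > 0\<close>] \<open>h > 0\<close>]])
    also have "\<dots> = (LINT z:{h..sqrt (R\<^sub>2\<^sup>2 + h\<^sup>2)}|lborel. LINT \<theta>:{0..2 * pi}|lborel.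
        1 / (pi * R\<^sub>2\<^sup>2) * (z * F k (polar_point c u (sqrt (z\<^sup>2 - h\<^sup>2)) \<theta>)))"
      by (simp only: set_integral_mult_right)
    also have "\<dots> = (LINT z:{h..sqrt (R\<^sub>2\<^sup>2 + h\<^sup>2)}|lborel. LINT \<theta>:{0..2 * pi}|lborel. ?f z \<theta>)"
      by (intro set_lebesgue_integral_cong) (auto simp only: integrand atLeastAtMost_iff, simp)
    finally show ?thesis .
  qed
  have E_disj: "E LOS \<inter> E NLOS = {}"
    by (auto simp: E_def)
  have "prob {\<omega> \<in> space M. downlink_sinr P_TBS P_ABS \<sigma> \<alpha>_T \<eta> \<alpha> c h (X \<omega>) (K \<omega>) (G \<omega>) (H \<omega>) > \<gamma>}
      = prob (E LOS \<union> E NLOS)"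
  proof (rule arg_cong[where f=prob], intro set_eqI)
    fix \<omega>
    show "\<omega> \<in> {\<omega> \<in> space M. downlink_sinr P_TBS P_ABS \<sigma> \<alpha>_T \<eta> \<alpha> c h (X \<omega>) (K \<omega>) (G \<omega>) (H \<omega>) > \<gamma>}
      \<longleftrightarrow> \<omega> \<in> E LOS \<union> E NLOS"
      by (cases "K \<omega>") (simp_all add: E_def)
  qed
  also have "\<dots> = (\<Sum>k\<in>{LOS, NLOS}. prob (E k))"
    using finite_measure_Union[OF E_meas E_meas E_disj] by simp
  finally show ?thesis
    by (simp only: prob_E polar)
qed

end
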